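(* Let $\alpha_1, A_1, A_2 > 0$ and consider the system of difference equations $$x_{n+1}=\frac{\alpha_{1}}{A_{1}+y_{n}},\qquad y_{n+1}=\frac{y_{n}}{A_{2}+y_{n}},\qquad n=0,1,2,\dots,$$ with arbitrary nonnegative initial conditions $x_0,y_0$. (1) If $A_{2}\geq 1$, then there is a unique equilibrium, namely $\left(\frac{\alpha_{1}}{A_{1}},0\right)$, and it is globally asymptotically stable. (2) If $A_{2}< 1$, then there are exactly two distinct equilibria. The equilibrium $\left(\frac{\alpha_{1}}{A_{1}},0\right)$ is a saddle with $[0,\infty)\times\{0\}$ as its stable manifold. Moreover, the equilibrium $\left(\frac{\alpha_{1}}{A_{1}+1-A_{2}},1-A_{2}\right)$ is locally asymptotically stable with attracting basin $[0,\infty)\times(0,\infty)$.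
   Context: The state space is $[0,\infty)^2$. An equilibrium is a point $(\bar x,\bar y)\in[0,\infty)^2$ such that the constant sequence $(x_n,y_n)=(\bar x,\bar y)$ solves the system. It is locally asymptotically stable if it is Lyapunov stable relative to $[0,\infty)^2$ and all solutions with initial conditions in $[0,\infty)^2$ sufficiently close to it converge to it; it is globally asymptotically stable if it is Lyapunov stable relative to $[0,\infty)^2$ and every solution with initial condition in $[0,\infty)^2$ converges to it. It is a saddle if the Jacobian matrix at the equilibrium of the map $(x_n,y_n)\mapsto(x_{n+1},y_{n+1})$ has one eigenvalue of modulus less than 1 and one of modulus greater than 1. The stable manifold of a saddle, and likewise the attracting basin of a locally asymptotically stable equilibrium, is the set of initial conditions in $[0,\infty)^2$ whose solutions converge to the equilibrium. *)

theory Defs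
  imports "HOL-Analysis.Analysis"
begin

definition solution :: "('a \<Rightarrow> 'a) \<Rightarrow> 'a set \<Rightarrow> (nat \<Rightarrow> 'a) \<Rightarrow> bool" where
  "solution f S z \<longleftrightarrow> z 0 \<in> S \<and> (\<forall>n. z (Suc n) = f (z n))"

definition equilibrium :: "('a \<Rightarrow> 'a) \<Rightarrow> 'a set \<Rightarrow> 'a \<Rightarrow> bool" where
  "equilibrium f S p \<longleftrightarrow> p \<in> S \<and> solution f S (\<lambda>n. p)"

definition lyapunov_stable :: "('a::metric_space \<Rightarrow> 'a) \<Rightarrow> 'a set \<Rightarrow> 'a \<Rightarrow> bool" where
  "lyapunov_stable f S p \<longleftrightarrow>
     (\<forall>\<epsilon>>0. \<exists>\<delta>>0. \<forall>z. solution f S z \<and> dist (z 0) p < \<delta> \<longrightarrow> (\<forall>n. dist (z n) p < \<epsilon>))"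

definition locally_asymptotically_stable :: "('a::metric_space \<Rightarrow> 'a) \<Rightarrow> 'a set \<Rightarrow> 'a \<Rightarrow> bool" where
  "locally_asymptotically_stable f S p \<longleftrightarrow>
     lyapunov_stable f S p \<and>
     (\<exists>\<delta>>0. \<forall>z. solution f S z \<and> dist (z 0) p < \<delta> \<longrightarrow> z \<longlonglongrightarrow> p)"

definition globally_asymptotically_stable :: "('a::metric_space \<Rightarrow> 'a) \<Rightarrow> 'a set \<Rightarrow> 'a \<Rightarrow> bool" where
  "globally_asymptotically_stable f S p \<longleftrightarrow>
     lyapunov_stable f S p \<and> (\<forall>z. solution f S z \<longrightarrow> z \<longlonglongrightarrow> p)"

definition attracting_basin :: "('a::topological_space \<Rightarrow> 'a) \<Rightarrow> 'a set \<Rightarrow> 'a \<Rightarrow> 'a set" where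
  "attracting_basin f S p = {q \<in> S. \<forall>z. solution f S z \<and> z 0 = q \<longrightarrow> z \<longlonglongrightarrow> p}"

text \<open>The stable manifold is meant globally: it is the set of all initial conditions whose
  solutions converge to the point, so it coincides with the basin as a set.\<close>

abbreviation (input) stable_manifold :: "('a::topological_space \<Rightarrow> 'a) \<Rightarrow> 'a set \<Rightarrow> 'a \<Rightarrow> 'a set" where
  "stable_manifold \<equiv> attracting_basin"

text \<open>Eigenvalues of a real matrix are taken over the complex numbers.\<close>

definition eigenvalue :: "real^'n^'n \<Rightarrow> complex \<Rightarrow> bool" where
  "eigenvalue A c \<longleftrightarrow> (\<exists>v. v \<noteq> 0 \<and> map_matrix complex_of_real A *v v = c *s v)"

text \<open>The derivative is the two-sided one, so \<open>f\<close> has to be given in a neighbourhood of \<open>p\<close> even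
  when \<open>p\<close> lies on the boundary of the state space.\<close>

definition saddle :: "(real^2 \<Rightarrow> real^2) \<Rightarrow> (real^2) set \<Rightarrow> real^2 \<Rightarrow> bool" where
  "saddle f S p \<longleftrightarrow>
     equilibrium f S p \<and> f differentiable (at p) \<and>
     (\<exists>c d. eigenvalue (jacobian f (at p)) c \<and> norm c < 1 \<and>
            eigenvalue (jacobian f (at p)) d \<and> norm d > 1)"

definition quadrant :: "(real^2) set" where
  "quadrant = {p. p $ 1 \<ge> 0 \<and> p $ 2 \<ge> 0}"

definition system_map :: "real \<Rightarrow> real \<Rightarrow> real \<Rightarrow> real^2 \<Rightarrow> real^2" where
  "system_map \<alpha>\<^sub>1 A\<^sub>1 A\<^sub>2 p = vector [\<alpha>\<^sub>1 / (A\<^sub>1 + p $ 2), p $ 2 / (A\<^sub>2 + p $ 2)]"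

end

theory Submission
  imports Defs
begin

text \<open>
  The second component evolves autonomously by \<open>g y = y / (B + y)\<close>, and the first component is a
  Lipschitz function of the previous second one. If \<open>b \<ge> 0\<close> is a fixed point of \<open>g\<close>, then
  \<open>g y - b = B / ((B + y) * (B + b)) * (y - b)\<close>, so \<open>g\<close> never increases the distance to \<open>b\<close> once
  \<open>B + b \<ge> 1\<close>, which gives stability. For \<open>B \<ge> 1\<close> attraction to \<open>0\<close> follows from \<open>n * y\<^sub>n \<le> 1\<close>.
  For \<open>B < 1\<close> a positive orbit stays above \<open>min y\<^sub>0 (1 - B)\<close>, which bounds the contraction factor
  towards \<open>b = 1 - B\<close> away from \<open>1\<close>.
\<close>

lemma system_map_nth [simp]:
  "system_map \<alpha> A B p $ 1 = \<alpha> / (A + p $ 2)"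
  "system_map \<alpha> A B p $ 2 = p $ 2 / (B + p $ 2)"
  by (simp_all add: system_map_def)

lemma vec2_eqI: "(p :: 'a ^ 2) $ 1 = q $ 1 \<Longrightarrow> p $ 2 = q $ 2 \<Longrightarrow> p = q"
  by (simp add: vec_eq_iff forall_2)

lemma equilibrium_iff: "equilibrium f S p \<longleftrightarrow> p \<in> S \<and> f p = p"
  by (auto simp: equilibrium_def solution_def)

lemma solution_iterates: "q \<in> S \<Longrightarrow> solution f S (\<lambda>n. (f ^^ n) q)"
  by (simp add: solution_def)

lemma dist_vec2_le:
  fixes p q :: "real ^ 2"
  shows "dist p q \<le> \<bar>p $ 1 - q $ 1\<bar> + \<bar>p $ 2 - q $ 2\<bar>"
  using norm_le_l1_cart[of "p - q"] by (simp add: dist_norm sum_2)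

section \<open>Linearization of the map and its eigenvalues\<close>

lemma system_map_has_derivative:
  assumes "A + p $ 2 \<noteq> 0" "B + p $ 2 \<noteq> 0"
  shows "(system_map \<alpha> A B has_derivative
           (\<lambda>h. vector [- \<alpha> / (A + p $ 2)\<^sup>2 * h $ 2, B / (B + p $ 2)\<^sup>2 * h $ 2])) (at p)"
proof -
  have 1: "((\<lambda>x. x $ 2) has_derivative (\<lambda>h. h $ 2)) (at p)" for p :: "real ^ 2"
    by (rule bounded_linear.has_derivative[OF bounded_linear_vec_nth has_derivative_ident])
  have c1: "((\<lambda>x. \<alpha> / (A + x $ 2)) has_derivative
          (\<lambda>h. - \<alpha> / (A + p $ 2)\<^sup>2 * h $ 2)) (at p)"
    using assms
    by (auto intro!: derivative_eq_intros 1 simp: fun_eq_iff field_simps power2_eq_square)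
  have c2: "((\<lambda>x. x $ 2 / (B + x $ 2)) has_derivative
          (\<lambda>h. B / (B + p $ 2)\<^sup>2 * h $ 2)) (at p)"
    using assms
    by (auto intro!: derivative_eq_intros 1 simp: fun_eq_iff divide_simps power2_eq_square)
       (simp_all add: algebra_simps)
  have "((\<lambda>x. system_map \<alpha> A B x $ i) has_derivative
      (\<lambda>h. vector [- \<alpha> / (A + p $ 2)\<^sup>2 * h $ 2, B / (B + p $ 2)\<^sup>2 * h $ 2] $ i)) (at p)" for i
    using exhaust_2[of i] c1 c2 by auto
  then show ?thesis
    by (subst has_derivative_componentwise_within)
       (auto simp: Basis_vec_def inner_axis)
qed

text \<open>The first column vanishes because neither component of the map depends on the first
  coordinate.\<close>

lemma system_map_jacobian:
  assumes "A + p $ 2 \<noteq> 0" "B + p $ 2 \<noteq> 0"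
  shows "jacobian (system_map \<alpha> A B) (at p) =
           vector [vector [0, - \<alpha> / (A + p $ 2)\<^sup>2], vector [0, B / (B + p $ 2)\<^sup>2]]"
  unfolding jacobian_def frechet_derivative_at[OF system_map_has_derivative[OF assms], symmetric]
  by (simp add: vec_eq_iff forall_2 matrix_def axis_def)

lemma eigenvalue_triangular:
  fixes a b :: real
  assumes "b \<noteq> 0"
  shows "eigenvalue (vector [vector [0, a], vector [0, b]] :: real ^ 2 ^ 2) 0"
    and "eigenvalue (vector [vector [0, a], vector [0, b]] :: real ^ 2 ^ 2) (of_real b)"
proof -
  show "eigenvalue (vector [vector [0, a], vector [0, b]] :: real ^ 2 ^ 2) 0"
    unfolding eigenvalue_def
    by (rule exI[of _ "vector [1, 0]"])
       (simp add: vec_eq_iff forall_2 matrix_vector_mult_def sum_2 map_matrix_def)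
  show "eigenvalue (vector [vector [0, a], vector [0, b]] :: real ^ 2 ^ 2) (of_real b)"
    unfolding eigenvalue_def using assms
    \<comment> \<open>The matrix sends every vector with second entry 1 to \<open>(a, b)\<close>,
      which is \<open>b\<close> times this witness.\<close>
    by (intro exI[of _ "vector [of_real (a / b), 1]"])
       (simp add: vec_eq_iff forall_2 matrix_vector_mult_def sum_2 map_matrix_def)
qed

section \<open>Equilibria of the system\<close>

locale planar_system =
  fixes \<alpha> A B :: real
  assumes pos: "\<alpha> > 0" "A > 0" "B > 0"
begin

abbreviation "F \<equiv> system_map \<alpha> A B"

abbreviation "fp b \<equiv> vector [\<alpha> / (A + b), b] :: real ^ 2"

text \<open>The second component gives \<open>y * (B + y) = y\<close>, hence the two roots, and the
  first coordinate is then forced. Intersecting with \<open>{0..}\<close> treats all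
  \<open>B\<close> at once: the root \<open>1 - B\<close> drops out for \<open>B > 1\<close> and
  merges with 0 for \<open>B = 1\<close>.\<close>

lemma equilibrium_fp_iff: "equilibrium F quadrant p \<longleftrightarrow> p $ 2 \<in> {0, 1 - B} \<inter> {0..} \<and> p = fp (p $ 2)"
proof
  assume "equilibrium F quadrant p"
  then have *: "p $ 1 \<ge> 0" "p $ 2 \<ge> 0" and eq: "F p = p"
    by (auto simp: equilibrium_iff quadrant_def)
  from eq have "\<alpha> / (A + p $ 2) = p $ 1" "p $ 2 / (B + p $ 2) = p $ 2"
    by (metis system_map_nth(1), metis system_map_nth(2))
  moreover from this(2) have "p $ 2 = 0 \<or> p $ 2 = 1 - B"
    using * pos by (simp add: divide_eq_eq) (metis add_diff_cancel_left' mult_cancel_left2)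
  ultimately show "p $ 2 \<in> {0, 1 - B} \<inter> {0..} \<and> p = fp (p $ 2)"
    using * by (auto intro!: vec2_eqI)
next
  assume *: "p $ 2 \<in> {0, 1 - B} \<inter> {0..} \<and> p = fp (p $ 2)"
  then have "p $ 1 = \<alpha> / (A + p $ 2)"
    by (metis vector_2(1))
  with * pos show "equilibrium F quadrant p"
    by (auto simp: equilibrium_iff quadrant_def intro!: vec2_eqI)
qed

section \<open>Distance estimates along an orbit and stability\<close>

lemma solution_snd_Suc: "solution F quadrant z \<Longrightarrow> z (Suc n) $ 2 = z n $ 2 / (B + z n $ 2)"
  by (simp add: solution_def)

lemma solution_fst_Suc: "solution F quadrant z \<Longrightarrow> z (Suc n) $ 1 = \<alpha> / (A + z n $ 2)"
  by (simp add: solution_def)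

lemma solution_snd_nonneg: "solution F quadrant z \<Longrightarrow> z n $ 2 \<ge> 0"
proof (induction n)
  case 0 then show ?case by (simp add: solution_def quadrant_def)
next
  case (Suc n) then show ?case using pos by (simp add: solution_snd_Suc)
qed

text \<open>On \<open>y \<ge> 0\<close> the slope of \<open>\<alpha> / (A + y)\<close> has modulus
  at most \<open>\<alpha> / A\<^sup>2\<close>. The bound starts at index 1, since the initial first
  coordinate is arbitrary.\<close>

lemma fst_dist_le:
  assumes "solution F quadrant z" "b \<ge> 0"
  shows "\<bar>z (Suc n) $ 1 - \<alpha> / (A + b)\<bar> \<le> \<alpha> / A\<^sup>2 * \<bar>z n $ 2 - b\<bar>"
proof -
  let ?y = "z n $ 2"
  have y: "?y \<ge> 0" using assms(1) by (rule solution_snd_nonneg)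
  have "z (Suc n) $ 1 - \<alpha> / (A + b) = \<alpha> * (b - ?y) / ((A + ?y) * (A + b))"
    using y assms pos by (simp add: solution_fst_Suc field_simps)
  then have "\<bar>z (Suc n) $ 1 - \<alpha> / (A + b)\<bar> = \<alpha> * \<bar>?y - b\<bar> / ((A + ?y) * (A + b))"
    using y assms pos by (simp add: abs_mult)
  also have "\<dots> \<le> \<alpha> * \<bar>?y - b\<bar> / A\<^sup>2"
    unfolding power2_eq_square using y assms pos
    by (intro divide_left_mono mult_mono) auto
  finally show ?thesis by simp
qed

text \<open>The last hypothesis is the fixed-point equation of the second component without
  division. An exact factor serves both stability, where it is at most 1, and geometric
  convergence.\<close>

lemma snd_dist_Suc:
  assumes "solution F quadrant z" "b \<ge> 0" "b * (B + b) = b"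
  shows "\<bar>z (Suc n) $ 2 - b\<bar> = B / ((B + z n $ 2) * (B + b)) * \<bar>z n $ 2 - b\<bar>"
proof -
  let ?y = "z n $ 2"
  have y: "?y \<ge> 0" using assms(1) by (rule solution_snd_nonneg)
  have "b / (B + b) = b"
    using assms pos by (simp add: field_simps)
  then have "z (Suc n) $ 2 - b = ?y / (B + ?y) - b / (B + b)"
    using assms(1) by (simp add: solution_snd_Suc)
  also have "\<dots> = B / ((B + ?y) * (B + b)) * (?y - b)"
    using y assms pos by (simp add: divide_simps) (simp add: algebra_simps)
  finally show ?thesis
    using y assms pos by (simp add: abs_mult)
qed

lemma snd_dist_le:
  assumes "solution F quadrant z" "b \<ge> 0" "b * (B + b) = b" "B + b \<ge> 1"
  shows "\<bar>z n $ 2 - b\<bar> \<le> \<bar>z 0 $ 2 - b\<bar>"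
proof (induction n)
  case (Suc n)
  have y: "z n $ 2 \<ge> 0" using assms(1) by (rule solution_snd_nonneg)
  have "B * 1 \<le> (B + z n $ 2) * (B + b)"
    using y assms pos by (intro mult_mono) auto
  then have "B / ((B + z n $ 2) * (B + b)) \<le> 1"
    using y assms pos by (simp add: field_simps)
  then have "\<bar>z (Suc n) $ 2 - b\<bar> \<le> 1 * \<bar>z n $ 2 - b\<bar>"
    unfolding snd_dist_Suc[OF assms(1-3)] by (rule mult_right_mono) simp
  with Suc show ?case by simp
qed simp

text \<open>The hypotheses cover both stable cases: \<open>b = 0\<close> with
  \<open>B \<ge> 1\<close>, and \<open>b = 1 - B\<close> with \<open>B < 1\<close>, where
  \<open>B + b = 1\<close>.\<close>

lemma lyapunov_stable_fp:
  assumes b: "b \<ge> 0" "b * (B + b) = b" "B + b \<ge> 1"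
  shows "lyapunov_stable F quadrant (fp b)"
  unfolding lyapunov_stable_def
proof (intro allI impI)
  fix e :: real assume "e > 0"
  define K where "K = \<alpha> / A\<^sup>2"
  have K: "K > 0" using pos by (simp add: K_def)
  show "\<exists>\<delta>>0. \<forall>z. solution F quadrant z \<and> dist (z 0) (fp b) < \<delta> \<longrightarrow> (\<forall>n. dist (z n) (fp b) < e)"
  \<comment> \<open>With this radius the first coordinate contributes less than
    \<open>K * e / (K + 1)\<close> and the second less than \<open>e / (K + 1)\<close>, which add up
    to \<open>e\<close>.\<close>
  proof (intro exI[of _ "e / (K + 1)"] conjI allI impI)
    show "e / (K + 1) > 0" using \<open>e > 0\<close> K by simp
    fix z n assume z: "solution F quadrant z \<and> dist (z 0) (fp b) < e / (K + 1)"
    have le: "e / (K + 1) \<le> e" using \<open>e > 0\<close> K by (simp add: field_simps)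
    have "\<bar>z 0 $ 2 - b\<bar> \<le> dist (z 0) (fp b)"
      using component_le_norm_cart[of "z 0 - fp b" 2] by (simp add: dist_norm)
    with z have y0: "\<bar>z 0 $ 2 - b\<bar> < e / (K + 1)" by simp
    show "dist (z n) (fp b) < e"
    \<comment> \<open>At time 0 there is no predecessor to control the first coordinate, so there
      the radius itself must be at most \<open>e\<close>.\<close>
    proof (cases n)
      case 0
      then show ?thesis using z le by simp
    next
      case (Suc m)
      have y: "\<bar>z i $ 2 - b\<bar> < e / (K + 1)" for i
        using snd_dist_le[of z b i] z b y0 by auto
      have "\<bar>z n $ 1 - \<alpha> / (A + b)\<bar> \<le> K * \<bar>z m $ 2 - b\<bar>"
        unfolding Suc K_def using z b by (intro fst_dist_le) auto
      also have "\<dots> < K * (e / (K + 1))"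
        using K y by (intro mult_strict_left_mono)
      finally have "dist (z n) (fp b) < K * (e / (K + 1)) + e / (K + 1)"
        using dist_vec2_le[of "z n" "fp b"] y[of n] by simp
      also have "\<dots> = (K + 1) * (e / (K + 1))" by (simp only: distrib_right mult_1)
      also have "\<dots> = e" using K by simp
      finally show ?thesis .
    qed
  qed
qed

section \<open>Convergence of orbits\<close>

lemma tendsto_fp:
  assumes "solution F quadrant z" "b \<ge> 0" "(\<lambda>n. z n $ 2) \<longlonglongrightarrow> b"
  shows "z \<longlonglongrightarrow> fp b"
proof (rule vec_tendstoI)
  have "(\<lambda>n. z (Suc n) $ 1) \<longlonglongrightarrow> \<alpha> / (A + b)"
    unfolding solution_fst_Suc[OF assms(1)] using assms pos by (intro tendsto_intros) auto
  then have "(\<lambda>n. z n $ 1) \<longlonglongrightarrow> \<alpha> / (A + b)"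
    by (rule LIMSEQ_imp_Suc)
  then show "(\<lambda>n. z n $ i) \<longlonglongrightarrow> fp b $ i" for i
    using exhaust_2[of i] assms(3) by auto
qed

text \<open>The decay rate \<open>1 / n\<close> also covers \<open>B = 1\<close>, where the map has
  slope 1 at 0 and no geometric rate is available.\<close>

lemma tendsto_fp_0:
  assumes z: "solution F quadrant z" and "B \<ge> 1"
  shows "z \<longlonglongrightarrow> fp 0"
proof (rule tendsto_fp[OF z order_refl])
  have le: "real n * z n $ 2 \<le> 1" for n
  proof (induction n)
    case (Suc n)
    have y: "z n $ 2 \<ge> 0" using z by (rule solution_snd_nonneg)
    \<comment> \<open>After clearing the denominator the claim is \<open>n * y \<le> B\<close>,
      which follows from \<open>n * y \<le> 1 \<le> B\<close>.\<close>
    show ?case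
      using Suc y \<open>B \<ge> 1\<close> by (simp add: solution_snd_Suc[OF z] field_simps)
  qed simp
  show "(\<lambda>n. z n $ 2) \<longlonglongrightarrow> 0"
  proof (rule tendsto_sandwich[OF _ _ tendsto_const lim_1_over_n])
    \<comment> \<open>Index 0 is left out because \<open>1 / 0 = 0\<close> would make the bound
      wrong there for a positive start.\<close>
    show "\<forall>\<^sub>F n in sequentially. z n $ 2 \<le> 1 / real n"
      using eventually_gt_at_top[of 0] by eventually_elim (use le in \<open>simp add: field_simps\<close>)
  qed (simp add: solution_snd_nonneg[OF z])
qed

lemma tendsto_fp_pos:
  assumes z: "solution F quadrant z" and "B < 1" and y0: "z 0 $ 2 > 0"
  shows "z \<longlonglongrightarrow> fp (1 - B)"
proof (rule tendsto_fp[OF z])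
  \<comment> \<open>\<open>m\<close> bounds the orbit away from 0, where the contraction towards
    \<open>1 - B\<close> would be lost; \<open>q\<close> is the resulting uniform factor.\<close>
  define m where "m = min (z 0 $ 2) (1 - B)"
  define q where "q = B / (B + m)"
  have m: "m > 0" "m \<le> 1 - B" using y0 \<open>B < 1\<close> by (auto simp: m_def)
  have q: "0 \<le> q" "q < 1" using m pos by (auto simp: q_def)
  have ge: "m \<le> z n $ 2" for n
  proof (induction n)
    case (Suc n)
    \<comment> \<open>The two summands use the two bounds on \<open>m\<close> separately:
      \<open>m \<le> z n $ 2\<close> in the first, \<open>m \<le> 1 - B\<close> in the
      second.\<close>
    have "m * (B + z n $ 2) = m * B + m * z n $ 2" by (simp add: algebra_simps)
    also have "\<dots> \<le> z n $ 2 * B + (1 - B) * z n $ 2"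
      using Suc m pos by (intro add_mono mult_right_mono) auto
    finally have "m * (B + z n $ 2) \<le> z n $ 2" by (simp add: algebra_simps)
    then show ?case
      using Suc m pos by (simp add: solution_snd_Suc[OF z] pos_le_divide_eq)
  qed (simp add: m_def)
  have le: "\<bar>z n $ 2 - (1 - B)\<bar> \<le> q ^ n * \<bar>z 0 $ 2 - (1 - B)\<bar>" for n
  proof (induction n)
    case (Suc n)
    have "\<bar>z (Suc n) $ 2 - (1 - B)\<bar> = B / (B + z n $ 2) * \<bar>z n $ 2 - (1 - B)\<bar>"
      using snd_dist_Suc[OF z, of "1 - B" n] \<open>B < 1\<close> by simp
    also have "\<dots> \<le> q * (q ^ n * \<bar>z 0 $ 2 - (1 - B)\<bar>)"
      unfolding q_def using ge[of n] m pos Suc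
      by (intro mult_mono divide_left_mono) (auto simp: q_def)
    finally show ?case by simp
  qed simp
  have "(\<lambda>n. q ^ n * \<bar>z 0 $ 2 - (1 - B)\<bar>) \<longlonglongrightarrow> 0"
    using q by (intro tendsto_mult_left_zero LIMSEQ_realpow_zero)
  then have "(\<lambda>n. z n $ 2 - (1 - B)) \<longlonglongrightarrow> 0"
    by (rule Lim_null_comparison[rotated]) (simp add: le)
  then show "(\<lambda>n. z n $ 2) \<longlonglongrightarrow> 1 - B"
    by (simp add: LIM_zero_iff)
  show "0 \<le> 1 - B" using \<open>B < 1\<close> by simp
qed

lemma tendsto_fp_axis:
  assumes z: "solution F quadrant z" and y0: "z 0 $ 2 = 0"
  shows "z \<longlonglongrightarrow> fp 0"
proof (rule tendsto_fp[OF z order_refl])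
  have "z n $ 2 = 0" for n
    by (induction n) (simp_all add: y0 solution_snd_Suc[OF z])
  then show "(\<lambda>n. z n $ 2) \<longlonglongrightarrow> 0" by simp
qed

section \<open>Basins and classification of the equilibria for \<open>B < 1\<close>\<close>

lemma attracting_basin_fp:
  assumes "B < 1"
  shows "attracting_basin F quadrant (fp 0) = {p. p $ 1 \<ge> 0 \<and> p $ 2 = 0}"
    and "attracting_basin F quadrant (fp (1 - B)) = {p. p $ 1 \<ge> 0 \<and> p $ 2 > 0}"
proof -
  have ne: "fp 0 \<noteq> fp (1 - B)"
    using assms by (auto simp: vec_eq_iff forall_2)
  \<comment> \<open>A solution is determined by its initial point, so quantifying over solutions
    amounts to looking at the iterates.\<close>
  have basin: "attracting_basin F quadrant p = {q \<in> quadrant. (\<lambda>n. (F ^^ n) q) \<longlonglongrightarrow> p}" for p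
  proof -
    have "z = (\<lambda>n. (F ^^ n) (z 0))" if "solution F quadrant z" for z
    proof
      show "z n = (F ^^ n) (z 0)" for n
        using that by (induction n) (simp_all add: solution_def)
    qed
    then show ?thesis
      unfolding attracting_basin_def using solution_iterates[of _ quadrant F] by fastforce
  qed
  have lim: "(\<lambda>n. (F ^^ n) q) \<longlonglongrightarrow> (if q $ 2 = 0 then fp 0 else fp (1 - B))" if "q \<in> quadrant" for q
    using tendsto_fp_axis[OF solution_iterates[OF that]]
      tendsto_fp_pos[OF solution_iterates[OF that] assms] that
    by (auto simp: quadrant_def)
  \<comment> \<open>Every orbit converges to one of two distinct points, so uniqueness of limits
    yields both basins at once.\<close>
  have char: "attracting_basin F quadrant p =
      {q \<in> quadrant. p = (if q $ 2 = 0 then fp 0 else fp (1 - B))}" for p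
    unfolding basin using lim LIMSEQ_unique by blast
  show "attracting_basin F quadrant (fp 0) = {p. p $ 1 \<ge> 0 \<and> p $ 2 = 0}"
    unfolding char using ne by (auto simp: quadrant_def)
  show "attracting_basin F quadrant (fp (1 - B)) = {p. p $ 1 \<ge> 0 \<and> p $ 2 > 0}"
    unfolding char using ne by (auto simp: quadrant_def)
qed

lemma saddle_fp_0:
  assumes "B < 1"
  shows "saddle F quadrant (fp 0)"
proof -
  let ?J = "vector [vector [0, - \<alpha> / A\<^sup>2], vector [0, 1 / B]] :: real ^ 2 ^ 2"
  have "jacobian F (at (fp 0)) = ?J"
    \<comment> \<open>The lower right entry \<open>B / B\<^sup>2\<close> reduces to
      \<open>1 / B\<close>, the eigenvalue of modulus above 1.\<close>
    using system_map_jacobian[of A "fp 0" B \<alpha>] pos by (simp add: power2_eq_square)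
  moreover have "F differentiable (at (fp 0))"
    using system_map_has_derivative[of A "fp 0" B \<alpha>] pos by (auto simp: differentiable_def)
  moreover have "eigenvalue ?J 0" "eigenvalue ?J (of_real (1 / B))"
    using eigenvalue_triangular[of "1 / B"] pos by auto
  moreover have "norm (of_real (1 / B) :: complex) > 1"
    using assms pos by (simp add: norm_divide)
  moreover have "equilibrium F quadrant (fp 0)"
    by (simp add: equilibrium_fp_iff)
  ultimately show ?thesis
    unfolding saddle_def by (metis norm_zero zero_less_one)
qed

lemma locally_asymptotically_stable_fp:
  assumes "B < 1"
  shows "locally_asymptotically_stable F quadrant (fp (1 - B))"
  unfolding locally_asymptotically_stable_def
\<comment> \<open>The radius \<open>1 - B\<close> is the distance from the equilibrium to the axis,
  so nearby starts have a positive second coordinate.\<close>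
proof (intro conjI exI[of _ "1 - B"] allI impI)
  show "lyapunov_stable F quadrant (fp (1 - B))"
    using assms by (intro lyapunov_stable_fp) auto
  show "0 < 1 - B" using assms by simp
  fix z assume z: "solution F quadrant z \<and> dist (z 0) (fp (1 - B)) < 1 - B"
  have "\<bar>z 0 $ 2 - (1 - B)\<bar> \<le> dist (z 0) (fp (1 - B))"
    using component_le_norm_cart[of "z 0 - fp (1 - B)" 2] by (simp add: dist_norm)
  with z have "z 0 $ 2 > 0" by linarith
  with z assms show "z \<longlonglongrightarrow> fp (1 - B)" by (blast intro: tendsto_fp_pos)
qed

end

theorem theorem10:
  fixes \<alpha>\<^sub>1 A\<^sub>1 A\<^sub>2 :: real
  assumes "\<alpha>\<^sub>1 > 0" and "A\<^sub>1 > 0" and "A\<^sub>2 > 0"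
  defines "f \<equiv> system_map \<alpha>\<^sub>1 A\<^sub>1 A\<^sub>2"
  shows
    "(A\<^sub>2 \<ge> 1 \<longrightarrow>
        {p. equilibrium f quadrant p} = {vector [\<alpha>\<^sub>1 / A\<^sub>1, 0]} \<and>
        globally_asymptotically_stable f quadrant (vector [\<alpha>\<^sub>1 / A\<^sub>1, 0])) \<and>
     (A\<^sub>2 < 1 \<longrightarrow>
        {p. equilibrium f quadrant p} =
          {vector [\<alpha>\<^sub>1 / A\<^sub>1, 0], vector [\<alpha>\<^sub>1 / (A\<^sub>1 + 1 - A\<^sub>2), 1 - A\<^sub>2]} \<and>
        (vector [\<alpha>\<^sub>1 / A\<^sub>1, 0] :: real^2) \<noteq> vector [\<alpha>\<^sub>1 / (A\<^sub>1 + 1 - A\<^sub>2), 1 - A\<^sub>2] \<and>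
        saddle f quadrant (vector [\<alpha>\<^sub>1 / A\<^sub>1, 0]) \<and>
        stable_manifold f quadrant (vector [\<alpha>\<^sub>1 / A\<^sub>1, 0]) = {p. p $ 1 \<ge> 0 \<and> p $ 2 = 0} \<and>
        locally_asymptotically_stable f quadrant (vector [\<alpha>\<^sub>1 / (A\<^sub>1 + 1 - A\<^sub>2), 1 - A\<^sub>2]) \<and>
        attracting_basin f quadrant (vector [\<alpha>\<^sub>1 / (A\<^sub>1 + 1 - A\<^sub>2), 1 - A\<^sub>2]) =
          {p. p $ 1 \<ge> 0 \<and> p $ 2 > 0})"
proof -
  interpret planar_system \<alpha>\<^sub>1 A\<^sub>1 A\<^sub>2
    using assms(1-3) by unfold_locales
  have fp: "vector [\<alpha>\<^sub>1 / A\<^sub>1, 0] = fp 0"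
      "vector [\<alpha>\<^sub>1 / (A\<^sub>1 + 1 - A\<^sub>2), 1 - A\<^sub>2] = fp (1 - A\<^sub>2)"
    by (simp_all add: add_diff_eq)
  \<comment> \<open>Written as an image, the equilibrium set in either case only requires evaluating
    the intersection.\<close>
  have equilibria: "{p. equilibrium f quadrant p} = fp ` ({0, 1 - A\<^sub>2} \<inter> {0..})"
    unfolding f_def equilibrium_fp_iff by (auto intro: image_eqI)
  show ?thesis
    unfolding fp equilibria
  proof (intro conjI impI)
    assume "A\<^sub>2 \<ge> 1"
    then have "{0, 1 - A\<^sub>2} \<inter> {0..} = {0}" by auto
    then show "fp ` ({0, 1 - A\<^sub>2} \<inter> {0..}) = {fp 0}"
      by (simp only: image_insert image_empty)
    show "globally_asymptotically_stable f quadrant (fp 0)"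
      unfolding globally_asymptotically_stable_def f_def
      using \<open>A\<^sub>2 \<ge> 1\<close> lyapunov_stable_fp[of 0] tendsto_fp_0 by simp
  next
    assume "A\<^sub>2 < 1"
    then have "{0, 1 - A\<^sub>2} \<inter> {0..} = {0, 1 - A\<^sub>2}" by auto
    then show "fp ` ({0, 1 - A\<^sub>2} \<inter> {0..}) = {fp 0, fp (1 - A\<^sub>2)}" by simp
    show "fp 0 \<noteq> fp (1 - A\<^sub>2)"
      using \<open>A\<^sub>2 < 1\<close> by (auto simp: vec_eq_iff forall_2)
  qed (use saddle_fp_0 attracting_basin_fp locally_asymptotically_stable_fp in \<open>simp_all add: f_def\<close>)
qed

end
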